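(* Let $n\ge 3$ be a fixed integer. Then $m(v,n)\ge (c_{n-1}+o(1))\,v\log_2 v$, where $o(1)\to 0$ as $v\to\infty$ and $c_{t}$ (for $t\ge 2$) is the constant in the Kleitman--Spencer bound for binary covering arrays of strength $t$.
   Context: All graphs are finite and simple. A graph $G$ is $n$-existentially closed ($n$-e.c.) if for all subsets $S\subseteq V(G)$ with $|S|=n$ and all partitions $S=A\sqcup B$ (with $A$ or $B$ possibly empty), there exists a vertex in $V(G)\setminus S$ adjacent to all vertices in $A$ and to no vertices in $B$. $m(v,n)$ denotes the minimum number of edges in an $n$-e.c. graph with $v$ vertices. A binary covering array $\mathrm{CA}(N,k,t)$ is an $N\times k$ $\{0,1\}$-matrix such that every $N\times t$ submatrix contains every binary vector of length $t$ as some row. The constants $c_t$ come from the known theorem of Kleitman and Spencer: for fixed $t\ge 2$, if a $\mathrm{CA}(N,k,t)$ exists then $N\ge (c_t+o(1))\log_2 k$ (as $k\to\infty$), where $c_t$ is a constant with $c_2=1$ and, for $t\ge 3$, $$c_t\ge\frac{t-2}{(t-1)2^{1-t}-(1-2^{1-t})\log_2(1-2^{1-t})-2^{2-t}}.$$ *)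

theory Defs
  imports "HOL-Analysis.Analysis" "HOL-Real_Asymp.Real_Asymp"
begin

definition simple_graph :: "'a set \<Rightarrow> 'a set set \<Rightarrow> bool" where
  "simple_graph V E \<longleftrightarrow> finite V \<and> E \<subseteq> {e. e \<subseteq> V \<and> card e = 2}"

definition existentially_closed :: "nat \<Rightarrow> 'a set \<Rightarrow> 'a set set \<Rightarrow> bool" where
  "existentially_closed n V E \<longleftrightarrow>
     (\<forall>S A B. S \<subseteq> V \<and> card S = n \<and> A \<union> B = S \<and> A \<inter> B = {} \<longrightarrow>
        (\<exists>z \<in> V - S. (\<forall>a\<in>A. {z, a} \<in> E) \<and> (\<forall>b\<in>B. {z, b} \<notin> E)))"

text \<open>Every finite graph is isomorphic to one with vertices in \<^typ>\<open>nat\<close>, so these suffice.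
  The minimum is \<open>\<infinity>\<close> if there is no \<open>n\<close>-e.c. graph on \<open>v\<close> vertices, which for fixed \<open>n\<close>
  happens for only finitely many \<open>v\<close>.\<close>

definition min_edges_ec :: "nat \<Rightarrow> nat \<Rightarrow> enat" where
  "min_edges_ec v n =
     Inf {enat (card E) | (V :: nat set) E.
       simple_graph V E \<and> card V = v \<and> existentially_closed n V E}"

text \<open>An \<open>N \<times> k\<close> matrix over \<open>{0,1}\<close> is a Boolean function of which only the values \<open>M i j\<close>
  with \<open>i < N\<close> and \<open>j < k\<close> matter.\<close>

definition covering_array :: "nat \<Rightarrow> nat \<Rightarrow> nat \<Rightarrow> (nat \<Rightarrow> nat \<Rightarrow> bool) \<Rightarrow> bool" where
  "covering_array N k t M \<longleftrightarrow>
     (\<forall>C \<subseteq> {..<k}. card C = t \<longrightarrow> (\<forall>x :: nat \<Rightarrow> bool. \<exists>i<N. \<forall>j\<in>C. M i j = x j))"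

definition kleitman_spencer_bound :: "nat \<Rightarrow> real \<Rightarrow> bool" where
  "kleitman_spencer_bound t c \<longleftrightarrow>
     (\<exists>\<delta> :: nat \<Rightarrow> real. \<delta> \<longlonglongrightarrow> 0 \<and>
        (\<forall>N k. (\<exists>M. covering_array N k t M) \<longrightarrow> (c + \<delta> k) * log 2 (real k) \<le> real N))"

text \<open>The best constant for which the bound holds; for \<open>t \<ge> 1\<close> the supremum is finite and attained by
  \<open>kleitman_spencer_const_bound\<close> and \<open>kleitman_spencer_const_greatest\<close> below. Hence it is at
  least every constant for which the bound is known.\<close>

definition kleitman_spencer_const :: "nat \<Rightarrow> real" where
  "kleitman_spencer_const t = Sup {c. kleitman_spencer_bound t c}"

lemma kleitman_spencer_bound_0: "kleitman_spencer_bound t 0"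
proof -
  have "(0 + 0) * log 2 (real k) \<le> real N" for k N by simp
  then show ?thesis unfolding kleitman_spencer_bound_def
    by (intro exI[of _ "\<lambda>_. 0"]) auto
qed

lemma card_subsets_inter:
  assumes "finite X" "C \<subseteq> X" "A \<subseteq> C"
  shows "card {R. R \<subseteq> X \<and> R \<inter> C = A} = 2 ^ (card X - card C)"
proof -
  have "bij_betw (\<lambda>Q. Q \<union> A) (Pow (X - C)) {R. R \<subseteq> X \<and> R \<inter> C = A}"
    by (rule bij_betw_byWitness[where f' = "\<lambda>R. R - C"]) (use assms in auto)
  then have "card {R. R \<subseteq> X \<and> R \<inter> C = A} = card (Pow (X - C))"
    by (simp add: bij_betw_same_card)
  then show ?thesis using assms
    by (simp add: card_Pow card_Diff_subset finite_subset)
qed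

definition patterns :: "nat \<Rightarrow> nat \<Rightarrow> (nat set \<times> nat set) set" where
  "patterns k t = (SIGMA C:{C. C \<subseteq> {..<k} \<and> card C = t}. Pow C)"

lemma finite_patterns: "finite (patterns k t)"
  unfolding patterns_def by (rule finite_SigmaI) (auto intro: finite_subset)

lemma card_patterns: "card (patterns k t) = (k choose t) * 2 ^ t"
proof -
  have "card (patterns k t) = (\<Sum>C\<in>{C. C \<subseteq> {..<k} \<and> card C = t}. card (Pow C))"
    unfolding patterns_def by (rule card_SigmaI) (auto intro: finite_subset)
  also have "\<dots> = (\<Sum>C\<in>{C. C \<subseteq> {..<k} \<and> card C = t}. 2 ^ t)"
    by (rule sum.cong) (auto simp: card_Pow finite_subset[OF _ finite_lessThan])
  also have "\<dots> = (k choose t) * 2 ^ t"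
    by (simp add: n_subsets)
  finally show ?thesis .
qed

lemma greedy_row:
  assumes U: "U \<subseteq> patterns k t"
  obtains R where "real (card {p\<in>U. R \<inter> fst p \<noteq> snd p}) \<le> (1 - 1 / 2 ^ t) * real (card U)"
proof -
  have fU: "finite U" using U finite_patterns finite_subset by blast
  let ?W = "Pow {..<k}"
  have "(\<Sum>R\<in>?W. \<Sum>p\<in>U. if R \<inter> fst p = snd p then 1 else (0::real))
      = (\<Sum>p\<in>U. \<Sum>R\<in>?W. if R \<inter> fst p = snd p then 1 else 0)"
    by (rule sum.swap)
  also have "\<dots> = (\<Sum>p\<in>U. 2 ^ k / 2 ^ t)"
  proof (rule sum.cong[OF refl])
    fix p assume "p \<in> U"
    then obtain C A where p: "p = (C, A)" "C \<subseteq> {..<k}" "card C = t" "A \<subseteq> C"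
      using U by (auto simp: patterns_def)
    have "t \<le> k" using p card_mono[of "{..<k}" C] by simp
    have "(\<Sum>R\<in>?W. if R \<inter> fst p = snd p then 1 else (0::real))
        = real (card {R \<in> ?W. R \<inter> C = A})"
      by (simp add: p sum.If_cases Int_def)
    also have "{R \<in> ?W. R \<inter> C = A} = {R. R \<subseteq> {..<k} \<and> R \<inter> C = A}" by auto
    also have "card \<dots> = 2 ^ (k - t)" using card_subsets_inter[of "{..<k}" C A] p by simp
    also have "real (2 ^ (k - t)) = 2 ^ k / 2 ^ t"
      unfolding of_nat_power of_nat_numeral by (rule power_diff) (use \<open>t \<le> k\<close> in auto)
    finally show "(\<Sum>R\<in>?W. if R \<inter> fst p = snd p then 1 else (0::real)) = 2 ^ k / 2 ^ t" .
  qed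
  finally have tot: "(\<Sum>R\<in>?W. \<Sum>p\<in>U. if R \<inter> fst p = snd p then 1 else (0::real))
      = real (card U) * (2 ^ k / 2 ^ t)" by simp
  have "\<exists>R\<in>?W. real (card U) / 2 ^ t \<le> (\<Sum>p\<in>U. if R \<inter> fst p = snd p then 1 else (0::real))"
  proof (rule ccontr)
    assume "\<not> ?thesis"
    then have "(\<Sum>R\<in>?W. \<Sum>p\<in>U. if R \<inter> fst p = snd p then 1 else (0::real))
        < (\<Sum>R\<in>?W. real (card U) / 2 ^ t)"
      by (intro sum_strict_mono) (auto simp: not_le)
    then show False using tot by (simp add: card_Pow mult.commute)
  qed
  then obtain R where
    R: "real (card U) / 2 ^ t \<le> (\<Sum>p\<in>U. if R \<inter> fst p = snd p then 1 else (0::real))" by blast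
  have "real (card U) = real (card {p\<in>U. R \<inter> fst p = snd p}) + real (card {p\<in>U. R \<inter> fst p \<noteq> snd p})"
    unfolding of_nat_add[symmetric]
    by (subst card_Un_disjoint[symmetric]) (auto simp: fU intro!: arg_cong[where f = card])
  moreover have "(\<Sum>p\<in>U. if R \<inter> fst p = snd p then 1 else (0::real))
      = real (card {p\<in>U. R \<inter> fst p = snd p})"
    using fU by (simp add: sum.If_cases Int_def)
  ultimately have "real (card {p\<in>U. R \<inter> fst p \<noteq> snd p}) \<le> (1 - 1 / 2 ^ t) * real (card U)"
    using R unfolding left_diff_distrib mult_1_left times_divide_eq_left by linarith
  then show ?thesis by (rule that)
qed

lemma greedy_rows:
  "\<exists>Rs. real (card {p\<in>patterns k t. \<forall>i<N. Rs i \<inter> fst p \<noteq> snd p})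
      \<le> (1 - 1 / 2 ^ t) ^ N * real (card (patterns k t))"
proof (induction N)
  case 0
  then show ?case by simp
next
  case (Suc N)
  then obtain Rs where
    Rs: "real (card {p\<in>patterns k t. \<forall>i<N. Rs i \<inter> fst p \<noteq> snd p})
      \<le> (1 - 1 / 2 ^ t) ^ N * real (card (patterns k t))" by blast
  let ?U = "{p\<in>patterns k t. \<forall>i<N. Rs i \<inter> fst p \<noteq> snd p}"
  obtain R where R: "real (card {p\<in>?U. R \<inter> fst p \<noteq> snd p}) \<le> (1 - 1 / 2 ^ t) * real (card ?U)"
    using greedy_row[of ?U k t] by blast
  have eq: "{p\<in>patterns k t. \<forall>i<Suc N. (Rs(N := R)) i \<inter> fst p \<noteq> snd p}
      = {p\<in>?U. R \<inter> fst p \<noteq> snd p}"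
    by (auto simp: less_Suc_eq)
  have "(1 - 1 / 2 ^ t) * real (card ?U)
      \<le> (1 - 1 / 2 ^ t) * ((1 - 1 / 2 ^ t) ^ N * real (card (patterns k t)))"
    by (rule mult_left_mono[OF Rs]) simp
  then have "real (card {p\<in>patterns k t. \<forall>i<Suc N. (Rs(N := R)) i \<inter> fst p \<noteq> snd p})
      \<le> (1 - 1 / 2 ^ t) ^ Suc N * real (card (patterns k t))"
    unfolding eq using R by simp
  then show ?case by blast
qed

lemma covering_array_exists:
  assumes "(1 - 1 / 2 ^ t) ^ N * real (card (patterns k t)) < 1"
  shows "\<exists>M. covering_array N k t M"
proof -
  obtain Rs where
    "real (card {p\<in>patterns k t. \<forall>i<N. Rs i \<inter> fst p \<noteq> snd p})
      \<le> (1 - 1 / 2 ^ t) ^ N * real (card (patterns k t))" using greedy_rows by blast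
  with assms have "real (card {p\<in>patterns k t. \<forall>i<N. Rs i \<inter> fst p \<noteq> snd p}) < 1" by linarith
  then have "card {p\<in>patterns k t. \<forall>i<N. Rs i \<inter> fst p \<noteq> snd p} = 0" by simp
  then have emp: "{p\<in>patterns k t. \<forall>i<N. Rs i \<inter> fst p \<noteq> snd p} = {}"
    using finite_patterns[of k t] by auto
  have "covering_array N k t (\<lambda>i j. j \<in> Rs i)"
    unfolding covering_array_def
  proof (intro allI impI)
    fix C and x :: "nat \<Rightarrow> bool"
    assume C: "C \<subseteq> {..<k}" "card C = t"
    let ?p = "(C, {j\<in>C. x j})"
    have "?p \<in> patterns k t" using C by (auto simp: patterns_def)
    moreover have "?p \<notin> {p\<in>patterns k t. \<forall>i<N. Rs i \<inter> fst p \<noteq> snd p}"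
      unfolding emp by simp
    ultimately have "\<not> (\<forall>i<N. Rs i \<inter> fst ?p \<noteq> snd ?p)" by (simp only: mem_Collect_eq) simp
    then obtain i where i: "i < N" "Rs i \<inter> fst ?p = snd ?p" by blast
    then have "Rs i \<inter> C = {j\<in>C. x j}" by simp
    with i(1) show "\<exists>i<N. \<forall>j\<in>C. (j \<in> Rs i) = x j" by blast
  qed
  then show ?thesis by blast
qed

lemma kleitman_spencer_bound_upper:
  assumes "t \<ge> 1" "kleitman_spencer_bound t c"
  shows "c \<le> real t / - log 2 (1 - 1 / 2 ^ t)"
proof -
  define q :: real where "q = 1 - 1 / 2 ^ t"
  define b where "b = - log 2 q"
  have "(2::real) ^ 1 \<le> 2 ^ t" using assms(1) by (intro power_increasing) auto
  then have q: "0 < q" "q < 1" by (auto simp: q_def field_simps)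
  then have b: "b > 0" by (simp add: b_def)
  obtain \<delta> where d: "\<delta> \<longlonglongrightarrow> 0"
    "\<And>N k. \<exists>M. covering_array N k t M \<Longrightarrow> (c + \<delta> k) * log 2 (real k) \<le> real N"
    using assms(2) unfolding kleitman_spencer_bound_def by blast
  have main: "(c + \<delta> k) * log 2 (real k) \<le> real t * log 2 (2 * real k) / b + 1" if k: "k \<ge> 1" for k
  proof -
    define y where "y = real t * log 2 (2 * real k) / b"
    have y0: "y \<ge> 0" using k b by (simp add: y_def)
    define N where "N = nat \<lfloor>y\<rfloor> + 1"
    have N: "y < real N" "real N \<le> y + 1" using y0 unfolding N_def by linarith+
    have "real (card (patterns k t)) \<le> (2 * real k) ^ t"
    proof -
      have "k choose t \<le> k ^ t" by (cases "t \<le> k") (simp_all add: binomial_le_pow binomial_eq_0)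
      then have "real (k choose t) \<le> real k ^ t" by (metis of_nat_le_iff of_nat_power)
      then show ?thesis by (simp add: card_patterns power_mult_distrib mult.commute)
    qed
    also have "(2 * real k) ^ t = 2 powr (y * b)"
    proof -
      have "2 powr (y * b) = (2 powr log 2 (2 * real k)) powr real t"
        unfolding powr_powr using b by (simp add: y_def mult.commute)
      then show ?thesis using k by (simp add: powr_realpow)
    qed
    finally have P: "real (card (patterns k t)) \<le> 2 powr (y * b)" .
    have qN: "q ^ N = 2 powr (- b * real N)"
      using q by (simp add: b_def powr_powr[symmetric] powr_realpow)
    have "q ^ N * real (card (patterns k t)) \<le> 2 powr (- b * real N) * 2 powr (y * b)"
      unfolding qN using P by (intro mult_left_mono) auto
    also have "\<dots> = 2 powr (b * (y - real N))" by (simp add: powr_add[symmetric] algebra_simps)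
    also have "\<dots> < 1" using b N by (simp add: powr_less_one mult_pos_neg)
    finally have "\<exists>M. covering_array N k t M"
      unfolding q_def by (rule covering_array_exists)
    from d(2)[OF this] N(2) show ?thesis unfolding y_def by linarith
  qed
  have "(\<lambda>k. c + \<delta> k) \<longlonglongrightarrow> c + 0" by (intro tendsto_intros d)
  moreover have "(\<lambda>k. (real t * log 2 (2 * real k) / b + 1) / log 2 (real k)) \<longlonglongrightarrow> real t / b"
  proof -
    have "(\<lambda>k. (real t * log 2 (2 * real k) / b + 1) / log 2 (real k))
        \<longlonglongrightarrow> real t * inverse (ln 2) * inverse b * ln 2"
      using b by real_asymp
    moreover have "real t * inverse (ln 2) * inverse b * ln 2 = real t / b"
      by (simp add: divide_inverse)
    ultimately show ?thesis by (simp only:)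
  qed
  moreover have "\<forall>\<^sub>F k in sequentially.
      c + \<delta> k \<le> (real t * log 2 (2 * real k) / b + 1) / log 2 (real k)"
    using eventually_ge_at_top[of 2]
  proof eventually_elim
    case (elim k)
    then have "log 2 (real k) > 0" by simp
    then show ?case using main[of k] elim by (simp add: pos_le_divide_eq)
  qed
  ultimately have "c + 0 \<le> real t / b"
    by (intro tendsto_le[OF sequentially_bot])
  then show ?thesis by (simp add: b_def q_def)
qed

lemma kleitman_spencer_bdd_above:
  "t \<ge> 1 \<Longrightarrow> bdd_above {c. kleitman_spencer_bound t c}"
  using kleitman_spencer_bound_upper by (intro bdd_aboveI) auto

theorem kleitman_spencer_const_greatest:
  assumes "t \<ge> 1" "kleitman_spencer_bound t c"
  shows "c \<le> kleitman_spencer_const t"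
  unfolding kleitman_spencer_const_def
  by (rule cSup_upper) (use assms kleitman_spencer_bdd_above in auto)

theorem kleitman_spencer_const_bound:
  assumes t: "t \<ge> 1"
  shows "kleitman_spencer_bound t (kleitman_spencer_const t)"
proof -
  let ?c = "kleitman_spencer_const t"
  let ?S = "\<lambda>k. {real N / log 2 (real k) | N. \<exists>M. covering_array N k t M}"
  define \<delta> where "\<delta> k = (if k < 2 \<or> ?S k = {} then 0 else min 0 (Inf (?S k) - ?c))" for k
  have bb: "bdd_below (?S k)" if "k \<ge> 2" for k
    using that by (intro bdd_belowI[of _ 0]) auto
  have ineq: "(?c + \<delta> k) * log 2 (real k) \<le> real N"
    if M: "\<exists>M. covering_array N k t M" for N k
  proof (cases "k < 2")
    case True
    then have "k = 0 \<or> k = 1" by auto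
    then have "log 2 (real k) = 0" by (auto simp: log_def)
    then show ?thesis by simp
  next
    case False
    then have l: "log 2 (real k) > 0" by simp
    have m: "real N / log 2 (real k) \<in> ?S k" using M by blast
    then have "Inf (?S k) \<le> real N / log 2 (real k)"
      using bb[of k] False by (intro cInf_lower) auto
    moreover have "\<delta> k \<le> Inf (?S k) - ?c" using False m unfolding \<delta>_def by (auto simp: min_def)
    ultimately have "?c + \<delta> k \<le> real N / log 2 (real k)" by linarith
    then show ?thesis using l by (simp add: pos_le_divide_eq)
  qed
  have "\<delta> \<longlonglongrightarrow> 0"
  proof (rule LIMSEQ_I)
    fix e :: real assume e: "e > 0"
    have "?c - e / 3 < Sup {c. kleitman_spencer_bound t c}"
      using e by (simp add: kleitman_spencer_const_def)
    then obtain c where c: "kleitman_spencer_bound t c" "?c - e / 3 < c"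
      using less_cSupD[of "{c. kleitman_spencer_bound t c}"] kleitman_spencer_bound_0 by blast
    then obtain \<epsilon> where d: "\<epsilon> \<longlonglongrightarrow> 0"
      "\<And>N k. \<exists>M. covering_array N k t M \<Longrightarrow> (c + \<epsilon> k) * log 2 (real k) \<le> real N"
      unfolding kleitman_spencer_bound_def by blast
    obtain k0 where k0: "\<And>k. k \<ge> k0 \<Longrightarrow> norm (\<epsilon> k - 0) < e / 3"
      using LIMSEQ_D[OF d(1), of "e / 3"] e by auto
    have "norm (\<delta> k - 0) < e" if k: "k \<ge> k0" for k
    proof (cases "k < 2 \<or> ?S k = {}")
      case True
      then show ?thesis using e by (simp add: \<delta>_def)
    next
      case False
      then have l: "log 2 (real k) > 0" by simp
      have "c + \<epsilon> k \<le> Inf (?S k)"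
      proof (rule cInf_greatest)
        show "?S k \<noteq> {}" using False by blast
        fix y assume "y \<in> ?S k"
        then obtain N where N: "y = real N / log 2 (real k)" "\<exists>M. covering_array N k t M" by blast
        show "c + \<epsilon> k \<le> y" unfolding N(1) using d(2)[OF N(2)] l by (simp add: pos_le_divide_eq)
      qed
      then have "Inf (?S k) - ?c > - (2 / 3) * e" using k0[OF k] c(2) by simp
      moreover have "\<delta> k = min 0 (Inf (?S k) - ?c)" using False unfolding \<delta>_def by (simp only: if_False)
      ultimately show ?thesis using e by (auto simp: min_def)
    qed
    then show "\<exists>k0. \<forall>k\<ge>k0. norm (\<delta> k - 0) < e" by blast
  qed
  then show ?thesis unfolding kleitman_spencer_bound_def using ineq by blast
qed

lemma kleitman_spencer_bound_2_1: "kleitman_spencer_bound 2 1"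
proof -
  have "(1 + 0) * log 2 (real k) \<le> real N" if M: "covering_array N k 2 M" for N k M
  proof (cases "k < 2")
    case True
    then have "k = 0 \<or> k = 1" by auto
    then have "log 2 (real k) = 0" by (auto simp: log_def)
    then show ?thesis by simp
  next
    case False
    have "inj_on (\<lambda>j. {i. i < N \<and> M i j}) {..<k}"
    proof (rule inj_onI, rule ccontr)
      fix a b assume ab: "a \<in> {..<k}" "b \<in> {..<k}"
        "{i. i < N \<and> M i a} = {i. i < N \<and> M i b}" "a \<noteq> b"
      then have "{a, b} \<subseteq> {..<k}" "card {a, b} = 2" by auto
      then obtain i where "i < N" "\<forall>j\<in>{a, b}. M i j = (j = a)"
        using M[unfolded covering_array_def, rule_format, of "{a, b}" "\<lambda>j. j = a"] by blast
      then show False using ab by auto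
    qed
    then have "card {..<k} \<le> card (Pow {..<N})"
      by (rule card_inj_on_le) auto
    then have "k \<le> 2 ^ N" by (simp add: card_Pow)
    then have "real k \<le> 2 ^ N" by (metis of_nat_le_iff of_nat_power of_nat_numeral)
    then have "log 2 (real k) \<le> log 2 (2 ^ N)" using False by (intro log_mono) auto
    then show ?thesis by simp
  qed
  then show ?thesis unfolding kleitman_spencer_bound_def
    by (intro exI[of _ "\<lambda>_. 0"]) auto
qed

lemma covering_array_2:
  assumes s: "s \<ge> 1"
  shows "\<exists>M. covering_array (2 * s) ((2 * s - 1) choose (s - 1)) 2 M"
proof -
  let ?k = "(2 * s - 1) choose (s - 1)"
  let ?G = "{B. B \<subseteq> {1..<2 * s} \<and> card B = s - 1}"
  have cG: "card ?G = ?k" by (simp add: n_subsets)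
  have "finite ?G" by (rule finite_subset[of _ "Pow {1..<2 * s}"]) auto
  then obtain f where f: "bij_betw f {0..<card ?G} ?G"
    using ex_bij_betw_nat_finite by blast
  define g where "g j = insert 0 (f j)" for j
  have fj: "f j \<subseteq> {1..<2 * s}" "card (f j) = s - 1" if "j < ?k" for j
    using f that unfolding bij_betw_def cG by auto
  have gj: "g j \<subseteq> {..<2 * s}" "card (g j) = s" "0 \<in> g j" "finite (g j)" if "j < ?k" for j
  proof -
    have fin: "finite (f j)" using fj(1)[OF that] finite_subset by blast
    have "0 \<notin> f j" using fj(1)[OF that] by auto
    then show "card (g j) = s" using fin fj(2)[OF that] s by (simp add: g_def)
    show "g j \<subseteq> {..<2 * s}" using fj(1)[OF that] s by (auto simp: g_def)
    show "0 \<in> g j" "finite (g j)" using fin by (auto simp: g_def)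
  qed
  have ginj: "g a \<noteq> g b" if "a < ?k" "b < ?k" "a \<noteq> b" for a b
  proof
    assume "g a = g b"
    moreover have "0 \<notin> f a" "0 \<notin> f b" using fj(1)[OF that(1)] fj(1)[OF that(2)] by auto
    ultimately have "f a = f b" unfolding g_def by (metis insert_ident)
    then show False using f that unfolding bij_betw_def cG inj_on_def by auto
  qed
  have diff: "\<exists>i<2 * s. i \<in> g a \<and> i \<notin> g b" if "a < ?k" "b < ?k" "a \<noteq> b" for a b
  proof (rule ccontr)
    assume "\<not> ?thesis"
    then have "g a \<subseteq> g b" using gj(1)[OF that(1)] by auto
    then have "g a = g b" using gj[OF that(1)] gj[OF that(2)] by (intro card_subset_eq) auto
    then show False using ginj that by blast
  qed
  have out: "\<exists>i<2 * s. i \<notin> g a \<and> i \<notin> g b" if "a < ?k" "b < ?k" for a b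
  proof (rule ccontr)
    assume "\<not> ?thesis"
    then have "{..<2 * s} \<subseteq> g a \<union> g b" by auto
    then have "card {..<2 * s} \<le> card (g a \<union> g b)"
      using gj(4)[OF that(1)] gj(4)[OF that(2)] by (intro card_mono) auto
    moreover have "card (g a \<union> g b) + card (g a \<inter> g b) = 2 * s"
      using card_Un_Int[of "g a" "g b"] gj[OF that(1)] gj[OF that(2)] by simp
    moreover have "card (g a \<inter> g b) > 0"
      using gj[OF that(1)] gj[OF that(2)] by (auto simp: card_gt_0_iff)
    ultimately show False by simp
  qed
  have "covering_array (2 * s) ?k 2 (\<lambda>i j. i \<in> g j)"
    unfolding covering_array_def
  proof (intro allI impI)
    fix C and x :: "nat \<Rightarrow> bool"
    assume C: "C \<subseteq> {..<?k}" "card C = 2"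
    then obtain a b where ab: "C = {a, b}" "a \<noteq> b" by (auto simp: card_2_iff)
    then have k: "a < ?k" "b < ?k" using C by auto
    show "\<exists>i<2 * s. \<forall>j\<in>C. (i \<in> g j) = x j"
    proof (cases "x a"; cases "x b")
      assume "x a" "x b"
      then show ?thesis using gj(3) k s ab by (intro exI[of _ 0]) auto
    next
      assume "x a" "\<not> x b"
      then show ?thesis using diff[OF k ab(2)] ab by auto
    next
      assume "\<not> x a" "x b"
      then show ?thesis using diff[OF k(2,1) ab(2)[symmetric]] ab by auto
    next
      assume "\<not> x a" "\<not> x b"
      then show ?thesis using out[OF k] ab by auto
    qed
  qed
  then show ?thesis by blast
qed

theorem kleitman_spencer_const_2: "kleitman_spencer_const 2 = 1"
proof (rule antisym)
  show "1 \<le> kleitman_spencer_const 2"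
    by (rule kleitman_spencer_const_greatest) (auto simp: kleitman_spencer_bound_2_1)
  let ?c = "kleitman_spencer_const 2"
  have "kleitman_spencer_bound 2 ?c" by (rule kleitman_spencer_const_bound) simp
  then obtain \<delta> where d: "\<delta> \<longlonglongrightarrow> 0"
    "\<And>N k. \<exists>M. covering_array N k 2 M \<Longrightarrow> (?c + \<delta> k) * log 2 (real k) \<le> real N"
    unfolding kleitman_spencer_bound_def by blast
  define K where "K s = (2 * s - 1) choose (s - 1)" for s :: nat
  have K: "real (K s) \<ge> 4 ^ s / (4 * real s)" if s: "s \<ge> 1" for s
  proof -
    have "2 * s choose s = 2 * K s"
    proof -
      have "2 * s choose s = Suc (2 * s - 1) choose Suc (s - 1)" using s by simp
      also have "\<dots> = (2 * s - 1 choose (s - 1)) + (2 * s - 1 choose Suc (s - 1))"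
        by (rule binomial_Suc_Suc)
      also have "(2 * s - 1 choose Suc (s - 1)) = (2 * s - 1 choose (s - 1))"
        using s by (subst binomial_symmetric) auto
      finally show ?thesis by (simp add: K_def)
    qed
    then show ?thesis using central_binomial_lower_bound[of s] s by (simp add: field_simps)
  qed
  have "filterlim (\<lambda>s. real (K s)) at_top sequentially"
  proof (rule filterlim_at_top_mono)
    show "filterlim (\<lambda>s. 4 ^ s / (4 * real s)) at_top sequentially" by real_asymp
    show "\<forall>\<^sub>F s in sequentially. 4 ^ s / (4 * real s) \<le> real (K s)"
      using eventually_ge_at_top[of 1] by eventually_elim (rule K)
  qed
  then have Kinf: "filterlim K sequentially sequentially"
    by (simp add: filterlim_sequentially_iff_filterlim_real)
  have "(\<lambda>s. ?c + \<delta> (K s)) \<longlonglongrightarrow> ?c + 0"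
    by (intro tendsto_intros filterlim_compose[OF d(1) Kinf])
  moreover have "(\<lambda>s. 2 * real s / log 2 (4 ^ s / (4 * real s))) \<longlonglongrightarrow> 1"
  proof -
    have "(\<lambda>s. 2 * real s / log 2 (4 ^ s / (4 * real s))) \<longlonglongrightarrow> 2 * (inverse (ln 4) * ln 2)"
      by real_asymp
    moreover have "ln (4::real) = 2 * ln 2" using ln_realpow[of "2::real" 2] by simp
    then have "2 * (inverse (ln 4) * ln 2) = (1::real)" by simp
    ultimately show ?thesis by simp
  qed
  moreover have "\<forall>\<^sub>F s in sequentially.
      ?c + \<delta> (K s) \<le> 2 * real s / log 2 (4 ^ s / (4 * real s))"
  proof -
    have "\<forall>\<^sub>F s in sequentially. 1 < (4::real) ^ s / (4 * real s)" by real_asymp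
    then show ?thesis using eventually_ge_at_top[of 1]
    proof eventually_elim
      case (elim s)
      have l: "log 2 (4 ^ s / (4 * real s)) > 0" using elim by (subst zero_less_log_cancel_iff) auto
      have le: "log 2 (4 ^ s / (4 * real s)) \<le> log 2 (real (K s))"
      proof (rule log_mono)
        show "0 < 4 ^ s / (4 * real s)" using elim by linarith
      qed (use K[of s] elim in auto)
      have N: "(?c + \<delta> (K s)) * log 2 (real (K s)) \<le> 2 * real s"
        using d(2)[OF covering_array_2[of s]] elim by (simp add: K_def)
      have "(?c + \<delta> (K s)) * log 2 (4 ^ s / (4 * real s)) \<le> 2 * real s"
      proof (cases "?c + \<delta> (K s) \<ge> 0")
        case True
        then show ?thesis using mult_left_mono[OF le True] N by linarith
      next
        case False
        then have "(?c + \<delta> (K s)) * log 2 (4 ^ s / (4 * real s)) \<le> 0"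
          using l by (intro mult_nonpos_nonneg) auto
        then show ?thesis by (meson of_nat_0_le_iff mult_nonneg_nonneg order_trans zero_le_numeral)
      qed
      then show ?case using l by (simp add: pos_le_divide_eq)
    qed
  qed
  ultimately have "?c + 0 \<le> 1" by (intro tendsto_le[OF sequentially_bot])
  then show "?c \<le> 1" by simp
qed

end

theory Submission
  imports Defs
begin

text \<open>
  The neighbourhood of a vertex \<open>x\<close> is a covering array of strength \<open>n - 1\<close>, which alone only bounds
  the degree of \<open>x\<close> and loses a factor \<open>2\<close> in the number of edges. To regain it, split the vertices
  at degree \<open>v powr (1/3)\<close>. If \<open>x\<close> has small degree, its neighbours of small degree see at most
  \<open>v powr (2/3)\<close> vertices altogether; on the remaining columns they are zero rows, so the
  neighbours of large degree already form, together with one zero row, a covering array with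
  \<open>v div 2\<close> columns. Hence almost every vertex sends \<open>(c + o(1)) log 2 v\<close> edges to vertices of
  large degree, and each such edge is counted once.
\<close>

section \<open>Neighbourhoods and edge counts\<close>

definition neighbors :: "'a set set \<Rightarrow> 'a \<Rightarrow> 'a set" where
  "neighbors E x = {z. {x, z} \<in> E}"

lemma neighbors_subset:
  assumes "simple_graph V E"
  shows "neighbors E x \<subseteq> V"
  using assms by (auto simp: neighbors_def simple_graph_def)

lemma finite_neighbors:
  assumes "simple_graph V E"
  shows "finite (neighbors E x)"
  using neighbors_subset[OF assms] assms by (auto simp: simple_graph_def intro: finite_subset)

lemma finite_edges:
  assumes "simple_graph V E"
  shows "finite E"
proof (rule finite_subset)
  show "E \<subseteq> Pow V" "finite (Pow V)" using assms by (auto simp: simple_graph_def)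
qed

text \<open>Handshake count: a pair of a vertex \<open>x\<close> and a neighbour \<open>z\<close> is
  sent injectively to the edge \<open>{x, z}\<close> with the marked end \<open>x\<close>, and each
  edge has two ends to mark.\<close>

lemma sum_card_neighbors_le:
  assumes G: "simple_graph V E" and H: "finite H"
  shows "(\<Sum>x\<in>H. card (neighbors E x)) \<le> 2 * card E"
proof -
  have ends: "finite e" "card e = 2" if "e \<in> E" for e
    using G that card_ge_0_finite[of e] by (auto simp: simple_graph_def)
  have "(\<Sum>x\<in>H. card (neighbors E x)) = card (SIGMA x:H. neighbors E x)"
    using H finite_neighbors[OF G] by (subst card_SigmaI) auto
  also have "\<dots> \<le> card (SIGMA e:E. e)"
  proof (rule card_inj_on_le[where f = "\<lambda>(x, z). ({x, z}, x)"])
    show "inj_on (\<lambda>(x, z). ({x, z}, x)) (SIGMA x:H. neighbors E x)"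
      by (auto simp: inj_on_def doubleton_eq_iff)
    show "(\<lambda>(x, z). ({x, z}, x)) ` (SIGMA x:H. neighbors E x) \<subseteq> (SIGMA e:E. e)"
      by (auto simp: neighbors_def)
    show "finite (SIGMA e:E. e)" using finite_edges[OF G] ends by auto
  qed
  also have "\<dots> = (\<Sum>e\<in>E. card e)" using finite_edges[OF G] ends by (subst card_SigmaI) auto
  also have "\<dots> = 2 * card E" using ends by simp
  finally show ?thesis .
qed

text \<open>Since \<open>L\<close> and \<open>H\<close> are disjoint, an edge between them
  determines which end lies in \<open>L\<close>. No end has to be marked, which is how the factor 2
  of the handshake count is saved.\<close>

lemma sum_card_cross_le:
  assumes G: "simple_graph V E" and L: "finite L" and disj: "L \<inter> H = {}"
  shows "(\<Sum>x\<in>L. card (neighbors E x \<inter> H)) \<le> card E"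
proof -
  have "(\<Sum>x\<in>L. card (neighbors E x \<inter> H)) = card (SIGMA x:L. neighbors E x \<inter> H)"
    using L finite_neighbors[OF G] by (subst card_SigmaI) auto
  also have "\<dots> \<le> card E"
  proof (rule card_inj_on_le[where f = "\<lambda>(x, z). {x, z}"])
    show "inj_on (\<lambda>(x, z). {x, z}) (SIGMA x:L. neighbors E x \<inter> H)"
      using disj by (auto simp: inj_on_def doubleton_eq_iff)
    show "(\<lambda>(x, z). {x, z}) ` (SIGMA x:L. neighbors E x \<inter> H) \<subseteq> E"
      by (auto simp: neighbors_def)
  qed (rule finite_edges[OF G])
  finally show ?thesis .
qed

section \<open>Covering arrays from neighbourhoods\<close>

text \<open>Columns are the vertices of \<open>J\<close>, rows the neighbours of \<open>x\<close> in
  \<open>H\<close>. A pattern on \<open>t\<close> columns, together with the demand to be adjacent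
  to \<open>x\<close>, is an instance of the closure property. If its witness lies outside
  \<open>H\<close>, then \<open>low\<close> makes it zero on all of \<open>J\<close>, so a single
  extra zero row replaces all such witnesses.\<close>

lemma ec_covering_array:
  assumes G: "simple_graph V E" and ec: "existentially_closed (Suc t) V E"
    and x: "x \<in> V" "x \<notin> J" and J: "J \<subseteq> V" "card J = k"
    and low: "\<And>z y. z \<in> neighbors E x \<Longrightarrow> z \<notin> H \<Longrightarrow> y \<in> J \<Longrightarrow> {z, y} \<notin> E"
  shows "\<exists>M. covering_array (Suc (card (neighbors E x \<inter> H))) k t M"
proof -
  let ?R = "neighbors E x \<inter> H"
  have fin: "finite ?R" "finite J"
    using finite_neighbors[OF G] finite_subset[OF J(1)] G by (auto simp: simple_graph_def)
  obtain f where f: "bij_betw f {0..<card ?R} ?R"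
    using ex_bij_betw_nat_finite[OF fin(1)] by blast
  obtain g where g: "bij_betw g {0..<k} J"
    using ex_bij_betw_nat_finite[OF fin(2)] unfolding J(2) by blast
  have gJ: "g j \<in> J" if "j < k" for j using g that by (auto simp: bij_betw_def)
  \<comment> \<open>Row \<open>card ?R\<close> is the extra zero row: there the conjunct
    \<open>i < card ?R\<close> fails.\<close>
  have "covering_array (Suc (card ?R)) k t (\<lambda>i j. i < card ?R \<and> {f i, g j} \<in> E)"
    unfolding covering_array_def
  proof (intro allI impI)
    fix C and p :: "nat \<Rightarrow> bool"
    assume C: "C \<subseteq> {..<k}" "card C = t"
    \<comment> \<open>Putting \<open>x\<close> into \<open>?A\<close> forces the witness to be a
      neighbour of \<open>x\<close>.\<close>
    let ?A = "insert x (g ` {j\<in>C. p j})" and ?B = "g ` {j\<in>C. \<not> p j}"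
    let ?S = "insert x (g ` C)"
    have inj: "inj_on g C"
      using g C(1) by (auto simp: bij_betw_def atLeast0LessThan intro: inj_on_subset)
    have CJ: "g ` C \<subseteq> J" using gJ C(1) by auto
    have "finite C" using C(1) finite_subset by blast
    then have "card ?S = Suc t"
      using CJ x(2) inj C(2) by (subst card_insert_disjoint) (auto simp: card_image)
    moreover have "?S \<subseteq> V" using x J CJ by auto
    moreover have "?A \<union> ?B = ?S" by auto
    moreover have "?A \<inter> ?B = {}" using inj CJ x(2) by (fastforce simp: inj_on_def)
    ultimately obtain z where z: "\<forall>a\<in>?A. {z, a} \<in> E" "\<forall>b\<in>?B. {z, b} \<notin> E"
      using ec[unfolded existentially_closed_def, rule_format, of ?S ?A ?B] by metis
    have zp: "({z, g j} \<in> E) = p j" if "j \<in> C" for j using z that by blast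
    have zx: "z \<in> neighbors E x" using z(1) by (auto simp: neighbors_def insert_commute)
    show "\<exists>i<Suc (card ?R). \<forall>j\<in>C. (i < card ?R \<and> {f i, g j} \<in> E) = p j"
    proof (cases "z \<in> H")
      case True
      then have "z \<in> f ` {0..<card ?R}" using zx bij_betw_imp_surj_on[OF f] by blast
      then obtain i where i: "i < card ?R" "f i = z" by (metis atLeastLessThan_iff imageE)
      then have "\<forall>j\<in>C. (i < card ?R \<and> {f i, g j} \<in> E) = p j" using zp by blast
      then show ?thesis using i(1) less_SucI by blast
    next
      case False
      \<comment> \<open>The prescribed pattern is zero on \<open>C\<close>, so row
        \<open>card ?R\<close> realises it.\<close>
      then have "\<not> p j" if "j \<in> C" for j
        using low[OF zx False, of "g j"] zp[OF that] CJ that by blast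
      then show ?thesis by blast
    qed
  qed
  then show ?thesis by blast
qed

section \<open>The edge bound for a single graph\<close>

text \<open>Bounds the number of columns to discard so that all rows from \<open>Z\<close> become
  zero.\<close>

lemma card_second_neighbors_le:
  fixes D :: real
  assumes G: "simple_graph V E" and x: "card (neighbors E x) \<le> D"
    and Z: "Z \<subseteq> neighbors E x" "\<And>z. z \<in> Z \<Longrightarrow> card (neighbors E z) \<le> D"
  shows "card (\<Union>z\<in>Z. neighbors E z) \<le> D * D"
proof -
  have fZ: "finite Z" using Z(1) finite_neighbors[OF G] finite_subset by blast
  have "D \<ge> 0" using x by (rule order_trans[rotated]) simp
  have "real (card (\<Union>z\<in>Z. neighbors E z)) \<le> (\<Sum>z\<in>Z. real (card (neighbors E z)))"
    using card_UN_le[OF fZ, of "neighbors E"] by (metis of_nat_le_iff of_nat_sum)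
  also have "\<dots> \<le> real (card Z) * D" using Z(2) by (rule sum_bounded_above)
  also have "\<dots> \<le> D * D"
  proof (rule mult_right_mono)
    have "card Z \<le> card (neighbors E x)" by (rule card_mono[OF finite_neighbors[OF G] Z(1)])
    then show "real (card Z) \<le> D" using x by linarith
  qed fact
  finally show ?thesis .
qed

text \<open>By the handshake count at most \<open>2 * card E / D\<close> vertices have degree above
  \<open>D\<close>. Each other vertex sends at least \<open>B\<close> edges to these, and the cross
  count adds them up without repetition. The \<open>Suc N\<close> in the hypothesis on
  \<open>B\<close> accounts for the zero row.\<close>

lemma ec_edges_ge:
  fixes D B :: real
  assumes G: "simple_graph V E" and ec: "existentially_closed (Suc t) V E"
    and D: "D > 0" "card V \<ge> k + 1 + D * D"
    and B: "B \<ge> 0" "\<And>N M. covering_array (Suc N) k t M \<Longrightarrow> B \<le> N"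
  shows "(card V - 2 * card E / D) * B \<le> card E"
proof -
  define H where "H = {x\<in>V. card (neighbors E x) > D}"
  define L where "L = V - H"
  have fV: "finite V" using G by (simp add: simple_graph_def)
  then have fin: "finite H" "finite L" by (auto simp: H_def L_def)
  have "real (card H) * D \<le> (\<Sum>x\<in>H. real (card (neighbors E x)))"
    by (rule sum_bounded_below) (auto simp: H_def)
  also have "\<dots> \<le> 2 * real (card E)"
    using sum_card_neighbors_le[OF G fin(1)] by (metis of_nat_le_iff of_nat_mult of_nat_numeral of_nat_sum)
  finally have "real (card H) \<le> 2 * card E / D" using D(1) by (simp add: pos_le_divide_eq)
  moreover have "card L = card V - card H" "card H \<le> card V"
    using fV fin(1) by (auto simp: L_def H_def card_Diff_subset intro: card_mono)
  ultimately have "card V - 2 * card E / D \<le> card L" by linarith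
  then have "(card V - 2 * card E / D) * B \<le> card L * B" using B(1) by (rule mult_right_mono)
  also have "\<dots> \<le> (\<Sum>x\<in>L. real (card (neighbors E x \<inter> H)))"
  proof (rule sum_bounded_below)
    fix x assume x: "x \<in> L"
    \<comment> \<open>\<open>W\<close> is everything seen by the low-degree neighbours of
      \<open>x\<close>; off \<open>W\<close> they are zero rows.\<close>
    define W where "W = (\<Union>z\<in>neighbors E x - H. neighbors E z)"
    have fW: "finite W"
      using neighbors_subset[OF G] fV by (auto simp: W_def intro: finite_subset)
    have "card W \<le> D * D" unfolding W_def
    proof (rule card_second_neighbors_le[OF G])
      show "card (neighbors E x) \<le> D" using x by (auto simp: L_def H_def)
      show "card (neighbors E z) \<le> D" if "z \<in> neighbors E x - H" for z
        using that neighbors_subset[OF G, of x] by (auto simp: H_def)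
    qed auto
    moreover have "card (insert x W) \<le> Suc (card W)" using fW by (simp add: card_insert_if)
    moreover have "card V - card (insert x W) \<le> card (V - insert x W)"
      using fW by (intro diff_card_le_card_Diff) simp
    \<comment> \<open>Discarding \<open>W\<close> costs at most \<open>D * D\<close> vertices and
      discarding \<open>x\<close> at most one more, which is the slack assumed for
      \<open>card V\<close>.\<close>
    ultimately have "k \<le> card (V - insert x W)" using D(2) by linarith
    then obtain J where J: "J \<subseteq> V - insert x W" "card J = k" by (meson obtain_subset_with_card_n)
    have "\<exists>M. covering_array (Suc (card (neighbors E x \<inter> H))) k t M"
      by (rule ec_covering_array[OF G ec, of x J])
        (use x J in \<open>auto simp: L_def W_def neighbors_def\<close>)
    then show "B \<le> card (neighbors E x \<inter> H)" using B(2) by blast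
  qed
  also have "\<dots> \<le> card E"
    using sum_card_cross_le[OF G fin(2), of H] by (auto simp: L_def simp flip: of_nat_sum)
  finally show ?thesis .
qed

section \<open>Minimum over all graphs and asymptotics\<close>

text \<open>By well-ordering the infimum is attained by some graph, unless there is none and it is
  infinite.\<close>

lemma le_min_edges_ec:
  fixes r :: real
  assumes "\<And>(V :: nat set) E. simple_graph V E \<Longrightarrow> card V = v \<Longrightarrow> existentially_closed n V E
    \<Longrightarrow> r \<le> card E"
  shows "ereal r \<le> ereal_of_enat (min_edges_ec v n)"
proof -
  let ?S = "{enat (card E) | (V :: nat set) E.
       simple_graph V E \<and> card V = v \<and> existentially_closed n V E}"
  show ?thesis
  proof (cases "?S = {}")
    case True
    then have "min_edges_ec v n = \<infinity>" unfolding min_edges_ec_def by (simp add: Inf_enat_def)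
    then show ?thesis by simp
  next
    case False
    then have "Inf ?S \<in> ?S" unfolding Inf_enat_def by (metis (mono_tags, lifting) LeastI ex_in_conv)
    then obtain V :: "nat set" and E where "min_edges_ec v n = enat (card E)"
      "simple_graph V E" "card V = v" "existentially_closed n V E"
      unfolding min_edges_ec_def by blast
    then show ?thesis using assms by simp
  qed
qed

theorem theorem15:
  fixes n :: nat
  assumes "n \<ge> 3"
  shows "\<exists>\<epsilon> :: nat \<Rightarrow> real. \<epsilon> \<longlonglongrightarrow> 0 \<and>
    (\<forall>v. ereal ((kleitman_spencer_const (n - 1) + \<epsilon> v) * real v * log 2 (real v))
           \<le> ereal_of_enat (min_edges_ec v n))"
proof -
  define t where "t = n - 1"
  have t: "t \<ge> 1" "Suc t = n" using assms by (auto simp: t_def)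
  define c where "c = kleitman_spencer_const t"
  have c0: "c \<ge> 0"
    unfolding c_def by (rule kleitman_spencer_const_greatest[OF t(1) kleitman_spencer_bound_0])
  obtain \<delta> where \<delta>: "\<delta> \<longlonglongrightarrow> 0"
    "\<And>N k M. covering_array N k t M \<Longrightarrow> (c + \<delta> k) * log 2 (real k) \<le> real N"
    using kleitman_spencer_const_bound[OF t(1)] unfolding kleitman_spencer_bound_def c_def by blast
  \<comment> \<open>The covering array bound for \<open>v div 2\<close> columns, less one for the
    zero row.\<close>
  define B where "B v = (c + \<delta> (v div 2)) * log 2 (real (v div 2)) - 1" for v
  \<comment> \<open>With threshold \<open>v powr (1/3)\<close> and at most
    \<open>c * v * log 2 v\<close> edges, at least the fraction \<open>a v\<close> of the vertices
    has low degree.\<close>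
  define a where "a v = 1 - 2 * c * log 2 (real v) / real v powr (1 / 3)" for v :: nat
  \<comment> \<open>These conditions hold for all large \<open>v\<close>; the last leaves room for
    \<open>v div 2\<close> columns after the discarding.\<close>
  define good where "good v \<longleftrightarrow> v \<ge> 2 \<and> a v \<ge> 0 \<and>
    real v \<ge> real v / 2 + 1 + real v powr (1 / 3) * real v powr (1 / 3)" for v :: nat
  \<comment> \<open>The cap at 0 keeps \<open>c + \<epsilon> v\<close> at most \<open>c\<close>,
    which settles graphs with many edges; the value \<open>- c\<close> makes the claimed bound 0 for
    the remaining \<open>v\<close>.\<close>
  define \<epsilon> where "\<epsilon> v = (if good v then min 0 (a v * (B v / log 2 (real v)) - c) else - c)" for v
  have "\<epsilon> \<longlonglongrightarrow> 0"
  proof -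
    have half: "filterlim (\<lambda>v::nat. v div 2) sequentially sequentially"
      by (rule filterlim_at_top_div_const_nat) simp
    have a1: "a \<longlonglongrightarrow> 1" unfolding a_def by real_asymp
    \<comment> \<open>Halving the number of columns does not change the logarithm to leading
      order.\<close>
    have "(\<lambda>v. log 2 (real (v div 2)) / log 2 (real v)) \<longlonglongrightarrow> 1"
    proof (rule tendsto_sandwich)
      show "(\<lambda>v. log 2 (real v / 2 - 1) / log 2 (real v)) \<longlonglongrightarrow> 1" by real_asymp
      show "(\<lambda>v. 1) \<longlonglongrightarrow> (1::real)" by simp
      show "\<forall>\<^sub>F v in sequentially.
          log 2 (real v / 2 - 1) / log 2 (real v) \<le> log 2 (real (v div 2)) / log 2 (real v)"
        using eventually_gt_at_top[of 2]
      proof eventually_elim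
        case (elim v)
        have "real v / 2 - 1 \<le> real (v div 2)" by linarith
        then show ?case using elim by (intro divide_right_mono log_mono) auto
      qed
      show "\<forall>\<^sub>F v in sequentially. log 2 (real (v div 2)) / log 2 (real v) \<le> 1"
        using eventually_gt_at_top[of 2] by eventually_elim (auto simp: divide_le_eq)
    qed
    moreover have "(\<lambda>v. 1 / log 2 (real v)) \<longlonglongrightarrow> 0" by real_asymp
    ultimately have "(\<lambda>v. (c + \<delta> (v div 2)) * (log 2 (real (v div 2)) / log 2 (real v))
        - 1 / log 2 (real v)) \<longlonglongrightarrow> (c + 0) * 1 - 0"
      by (intro tendsto_intros filterlim_compose[OF \<delta>(1) half])
    then have "(\<lambda>v. B v / log 2 (real v)) \<longlonglongrightarrow> c"
      by (simp add: B_def diff_divide_distrib)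
    then have "(\<lambda>v. min 0 (a v * (B v / log 2 (real v)) - c)) \<longlonglongrightarrow> min 0 (1 * c - c)"
      by (intro tendsto_intros a1)
    moreover have "\<forall>\<^sub>F v in sequentially. good v"
    proof -
      have "\<forall>\<^sub>F v in sequentially.
          real v \<ge> real v / 2 + 1 + real v powr (1 / 3) * real v powr (1 / 3)" by real_asymp
      moreover have "\<forall>\<^sub>F v in sequentially. a v > 0" by (rule order_tendstoD[OF a1]) simp
      ultimately show ?thesis using eventually_ge_at_top[of 2]
        by eventually_elim (simp add: good_def)
    qed
    then have "\<forall>\<^sub>F v in sequentially. min 0 (a v * (B v / log 2 (real v)) - c) = \<epsilon> v"
      by eventually_elim (simp add: \<epsilon>_def)
    ultimately show ?thesis by (auto intro: Lim_transform_eventually)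
  qed
  moreover have "ereal ((c + \<epsilon> v) * real v * log 2 (real v)) \<le> ereal_of_enat (min_edges_ec v n)" for v
  proof (rule le_min_edges_ec)
    fix V :: "nat set" and E
    assume G: "simple_graph V E" and V: "card V = v" and ec: "existentially_closed n V E"
    let ?l = "log 2 (real v)" and ?D = "real v powr (1 / 3)"
    show "(c + \<epsilon> v) * real v * ?l \<le> card E"
    proof (cases "good v")
      case False
      then show ?thesis by (simp add: \<epsilon>_def)
    next
      case True
      then have v: "v \<ge> 2" "a v \<ge> 0" and big: "real v \<ge> real v / 2 + 1 + ?D * ?D"
        by (auto simp: good_def)
      have l: "?l > 0" using v by simp
      have vl: "real v * ?l \<ge> 0" using l by simp
      have "c + \<epsilon> v \<le> c" using True by (simp add: \<epsilon>_def)
      then have le1: "(c + \<epsilon> v) * real v * ?l \<le> c * (real v * ?l)"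
        unfolding mult.assoc using vl by (rule mult_right_mono)
      have "c + \<epsilon> v \<le> a v * (B v / ?l)" using True by (simp add: \<epsilon>_def)
      then have "(c + \<epsilon> v) * real v * ?l \<le> a v * (B v / ?l) * (real v * ?l)"
        unfolding mult.assoc[of "c + \<epsilon> v"] using vl by (rule mult_right_mono)
      also have "\<dots> = real v * a v * B v" using l by simp
      finally have le2: "(c + \<epsilon> v) * real v * ?l \<le> real v * a v * B v" .
      \<comment> \<open>Either the edges already suffice, or the bound in \<open>le2\<close> is not
        positive, or the upper bound on \<open>card E\<close> limits the number of high-degree
        vertices and \<open>ec_edges_ge\<close> applies.\<close>
      consider "c * (real v * ?l) \<le> card E" | "B v \<le> 0" | "card E \<le> c * (real v * ?l)" "B v \<ge> 0"
        by linarith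
      then show ?thesis
      proof cases
        case 1
        then show ?thesis using le1 by linarith
      next
        case 2
        then have "real v * a v * B v \<le> 0" using v by (intro mult_nonneg_nonpos) auto
        then show ?thesis using le2 by linarith
      next
        case 3
        have "2 * real (card E) / ?D \<le> 2 * (c * (real v * ?l)) / ?D"
          using 3(1) by (intro divide_right_mono) auto
        then have "real v * a v \<le> card V - 2 * card E / ?D"
          by (simp add: a_def V algebra_simps)
        then have "real v * a v * B v \<le> (card V - 2 * card E / ?D) * B v"
          using 3(2) by (rule mult_right_mono)
        also have "\<dots> \<le> card E"
        proof (rule ec_edges_ge[OF G])
          show "existentially_closed (Suc t) V E" using ec t(2) by simp
          show "?D > 0" using v by simp
          have "real (v div 2) \<le> real v / 2" by linarith
          then show "card V \<ge> real (v div 2) + 1 + ?D * ?D" unfolding V using big by linarith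
          show "B v \<le> N" if "covering_array (Suc N) (v div 2) t M" for N M
            using \<delta>(2)[OF that] by (simp add: B_def)
        qed (rule 3(2))
        finally show ?thesis using le2 by linarith
      qed
    qed
  qed
  ultimately show ?thesis unfolding c_def t_def by blast
qed

end
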